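(* Let $X$ be a (real) Banach space and let $E$ be a real Archimedean vector lattice such that: (a) $E$ is Dedekind $\sigma$-complete; (b) $\tau$ is a metrisable, Hausdorff, locally solid linear topology on $E$ that has the $\sigma$-Lebesgue property; (c) $T_n \colon X \to E$, $n \in \mathbb{N}$, are linear operators that are continuous with respect to the norm topology on $X$ and the topology $\tau$ on $E$; (d) for each $x \in X$ the sequence $(T_n x)_{n \in \mathbb{N}}$ is order bounded in $E$. Then the maximal operator $$T^\star \colon X \to E_+, \qquad T^\star x := \sup_{n \in \mathbb{N}} |T_n x|$$ is continuous at $0$ (with respect to the norm topology on $X$ and $\tau$ on $E$).
   Context: A vector lattice $E$ is Dedekind $\sigma$-complete if every countable non-empty subset of $E$ which is bounded above has a supremum. A set is order bounded if it is contained in an order interval $[a,b]$. A subset $A \subseteq E$ is solid if $|y| \le |x|$ and $x \in A$ imply $y \in A$. A linear topology on $E$ is locally solid if it admits a neighbourhood base of zero consisting of solid sets. It has the $\sigma$-Lebesgue property if, for every sequence, $x_n \downarrow 0$ (decreasing with infimum $0$) implies $x_n \to 0$ in $\tau$. *)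

theory Defs
  imports
    "HOL-Analysis.Analysis"
    "HOL-Library.Lattice_Algebras"
    "HOL-Library.Lub_Glb"
begin

class vector_lattice = ordered_real_vector + lattice_ab_group_add_abs

class archimedean_vector_lattice = vector_lattice +
  assumes archimedean: "(\<And>n::nat. of_nat n *\<^sub>R x \<le> y) \<Longrightarrow> x \<le> 0"

text \<open>No completeness is built into the type, so suprema and infima are expressed by
  \<^const>\<open>isLub\<close> and \<^const>\<open>isGlb\<close> relative to the whole space.\<close>

definition dedekind_sigma_complete :: "'e::vector_lattice itself \<Rightarrow> bool"
  where "dedekind_sigma_complete _ \<longleftrightarrow>
    (\<forall>A::'e set. countable A \<and> A \<noteq> {} \<and> (\<exists>b. \<forall>a\<in>A. a \<le> b) \<longrightarrow> (\<exists>s. isLub UNIV A s))"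

definition order_bounded :: "'e::vector_lattice set \<Rightarrow> bool"
  where "order_bounded A \<longleftrightarrow> (\<exists>a b. A \<subseteq> {a..b})"

definition solid :: "'e::vector_lattice set \<Rightarrow> bool"
  where "solid A \<longleftrightarrow> (\<forall>x y. x \<in> A \<and> \<bar>y\<bar> \<le> \<bar>x\<bar> \<longrightarrow> y \<in> A)"

text \<open>The topology is an explicit argument and carries no Hausdorff requirement here.\<close>

definition linear_topology :: "'e::real_vector topology \<Rightarrow> bool"
  where "linear_topology \<tau> \<longleftrightarrow>
    topspace \<tau> = UNIV \<and>
    continuous_map (prod_topology \<tau> \<tau>) \<tau> (\<lambda>(x, y). x + y) \<and>
    continuous_map (prod_topology (euclidean :: real topology) \<tau>) \<tau> (\<lambda>(c, x). c *\<^sub>R x)"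

text \<open>The members of the neighbourhood base need not be open.\<close>

definition locally_solid :: "'e::vector_lattice topology \<Rightarrow> bool"
  where "locally_solid \<tau> \<longleftrightarrow> linear_topology \<tau> \<and> neighbourhood_base_at 0 solid \<tau>"

definition sigma_lebesgue_property :: "'e::vector_lattice topology \<Rightarrow> bool"
  where "sigma_lebesgue_property \<tau> \<longleftrightarrow>
    (\<forall>x::nat \<Rightarrow> 'e. decseq x \<and> isGlb UNIV (range x) 0 \<longrightarrow> limitin \<tau> x 0 sequentially)"

definition maximal_operator :: "(nat \<Rightarrow> 'x \<Rightarrow> 'e::vector_lattice) \<Rightarrow> 'x \<Rightarrow> 'e"
  where "maximal_operator T x = (THE s. isLub UNIV (range (\<lambda>n. \<bar>T n x\<bar>)) s)"

text \<open>The description in the definition is unique whenever the supremum exists.\<close>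

lemma maximal_operator_eqI:
  assumes "isLub UNIV (range (\<lambda>n. \<bar>T n x\<bar>)) s"
  shows "maximal_operator T x = s"
  unfolding maximal_operator_def
  using assms by (intro the_equality) (auto intro: antisym isLub_le_isUb isLub_isUb)

end

theory Submission
  imports Defs
begin

text \<open>Fix a solid neighbourhood \<open>V\<close> of \<open>0\<close>. The sets \<open>{x. T\<^sup>\<star> x / k \<in> V}\<close> cover the Banach
  space, so by Baire's theorem one of them is dense in a ball. For \<open>y\<close> in that ball and \<open>z\<close> in the
  dense set close to \<open>y\<close>, the supremum of \<open>\<bar>T\<^sub>n y\<bar>\<close> over \<open>n \<le> N\<close> is at most
  \<open>T\<^sup>\<star> z + (\<Sum>n\<le>N. \<bar>T\<^sub>n (y - z)\<bar>)\<close>, where the finite sum is small by continuity, while the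
  \<open>\<sigma>\<close>-Lebesgue property makes the partial suprema converge to \<open>T\<^sup>\<star> y\<close>. Hence \<open>T\<^sup>\<star> y / k\<close> lies
  in \<open>V + V + V\<close> on the whole ball, and sublinearity of \<open>T\<^sup>\<star>\<close> moves the ball to the origin. Bounding
  the partial suprema at nearby points avoids any need for closed solid neighbourhoods.\<close>

lemma solidD: "solid A \<Longrightarrow> x \<in> A \<Longrightarrow> \<bar>y\<bar> \<le> \<bar>x\<bar> \<Longrightarrow> y \<in> A"
  unfolding solid_def by blast

lemma solid_le: "solid A \<Longrightarrow> x \<in> A \<Longrightarrow> 0 \<le> y \<Longrightarrow> y \<le> x \<Longrightarrow> y \<in> A"
  by (rule solidD) auto

lemma abs_scaleR_le:
  fixes a :: "'e::vector_lattice"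
  assumes "0 \<le> c"
  shows "\<bar>c *\<^sub>R a\<bar> \<le> c *\<^sub>R \<bar>a\<bar>"
proof (rule abs_leI)
  show "c *\<^sub>R a \<le> c *\<^sub>R \<bar>a\<bar>"
    using assms by (intro scaleR_left_mono abs_ge_self)
  have "c *\<^sub>R (- a) \<le> c *\<^sub>R \<bar>a\<bar>"
    using assms by (intro scaleR_left_mono abs_ge_minus_self)
  then show "- (c *\<^sub>R a) \<le> c *\<^sub>R \<bar>a\<bar>"
    by simp
qed

lemma order_bounded_abs:
  assumes "order_bounded A"
  obtains b where "\<And>a. a \<in> A \<Longrightarrow> \<bar>a\<bar> \<le> b"
proof -
  obtain l u where A: "A \<subseteq> {l..u}"
    using assms unfolding order_bounded_def by blast
  have "\<bar>a\<bar> \<le> sup u (- l)" if "a \<in> A" for a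
  proof (rule abs_leI)
    show "a \<le> sup u (- l)" using A that by (intro le_supI1) auto
    show "- a \<le> sup u (- l)" using A that by (intro le_supI2) auto
  qed
  then show thesis by (rule that)
qed

text \<open>\<open>V\<close> itself may fail to be open, as the members of the base in
  \<open>locally_solid\<close> may. An open \<open>U\<close> inside \<open>V\<close> is what
  continuity and \<open>limitin\<close> arguments work with, while \<open>V\<close> carries the
  solidity.\<close>

definition solid_nhd :: "'e::vector_lattice topology \<Rightarrow> 'e set \<Rightarrow> bool"
  where "solid_nhd \<tau> V \<longleftrightarrow> solid V \<and> (\<exists>U. openin \<tau> U \<and> 0 \<in> U \<and> U \<subseteq> V)"

lemma solid_nhd_solid: "solid_nhd \<tau> V \<Longrightarrow> solid V"
  and solid_nhd_zero: "solid_nhd \<tau> V \<Longrightarrow> 0 \<in> V"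
  unfolding solid_nhd_def by auto

lemma solid_nhd_subset:
  assumes "locally_solid \<tau>" "openin \<tau> W" "0 \<in> W"
  obtains V where "solid_nhd \<tau> V" "V \<subseteq> W"
  using assms unfolding locally_solid_def neighbourhood_base_at_def solid_nhd_def by meson

text \<open>Continuity of addition at \<open>(0, 0)\<close> gives an open box
  \<open>A \<times> B\<close> whose sums stay in \<open>W\<close>; a solid neighbourhood inside
  \<open>A \<inter> B\<close> then serves for both summands.\<close>

lemma solid_nhd_add:
  assumes \<tau>: "locally_solid \<tau>" and W: "solid_nhd \<tau> W"
  obtains V where "solid_nhd \<tau> V" "\<And>a b. a \<in> V \<Longrightarrow> b \<in> V \<Longrightarrow> a + b \<in> W"
proof -
  obtain O' where O': "openin \<tau> O'" "0 \<in> O'" "O' \<subseteq> W"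
    using W unfolding solid_nhd_def by blast
  have cont: "continuous_map (prod_topology \<tau> \<tau>) \<tau> (\<lambda>(x, y). x + y)"
    and top: "topspace \<tau> = UNIV"
    using \<tau> unfolding locally_solid_def linear_topology_def by auto
  have "openin (prod_topology \<tau> \<tau>) {p. (case p of (x, y) \<Rightarrow> x + y) \<in> O'}"
    using openin_continuous_map_preimage [OF cont O'(1)] top by simp
  moreover have "(0, 0) \<in> {p. (case p of (x, y) \<Rightarrow> x + y) \<in> O'}"
    using O' by simp
  ultimately obtain A B where AB: "openin \<tau> A" "openin \<tau> B" "0 \<in> A" "0 \<in> B"
    "A \<times> B \<subseteq> {p. (case p of (x, y) \<Rightarrow> x + y) \<in> O'}"
    unfolding openin_prod_topology_alt by meson
  obtain V where V: "solid_nhd \<tau> V" "V \<subseteq> A \<inter> B"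
    using solid_nhd_subset [OF \<tau>, of "A \<inter> B"] AB by blast
  show thesis
  proof (rule that [OF V(1)])
    fix a b assume "a \<in> V" "b \<in> V"
    then have "(a, b) \<in> A \<times> B"
      using V(2) by auto
    then have "a + b \<in> O'"
      using AB(5) by auto
    then show "a + b \<in> W"
      using O'(3) by (rule subsetD [rotated])
  qed
qed

text \<open>Scalar multiplication is continuous at \<open>(0, x)\<close>, and
  \<open>inverse (real (Suc n))\<close> tends to \<open>0\<close>. This makes the sets in the Baire
  argument cover the whole space.\<close>

lemma solid_nhd_absorbing:
  assumes \<tau>: "locally_solid \<tau>" and W: "solid_nhd \<tau> W"
  obtains n where "x /\<^sub>R real (Suc n) \<in> W"
proof -
  obtain O' where O': "openin \<tau> O'" "0 \<in> O'" "O' \<subseteq> W"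
    using W unfolding solid_nhd_def by blast
  have cont: "continuous_map (prod_topology (euclidean :: real topology) \<tau>) \<tau> (\<lambda>(c, x). c *\<^sub>R x)"
    and top: "topspace \<tau> = UNIV"
    using \<tau> unfolding locally_solid_def linear_topology_def by auto
  have "openin (prod_topology (euclidean :: real topology) \<tau>) {p. (case p of (c, x) \<Rightarrow> c *\<^sub>R x) \<in> O'}"
    using openin_continuous_map_preimage [OF cont O'(1)] top by simp
  moreover have "(0, x) \<in> {p. (case p of (c, x) \<Rightarrow> c *\<^sub>R x) \<in> O'}"
    using O' by simp
  ultimately obtain A B where AB: "openin euclidean A" "x \<in> B" "0 \<in> A"
    "A \<times> B \<subseteq> {p. (case p of (c, x) \<Rightarrow> c *\<^sub>R x) \<in> O'}"
    unfolding openin_prod_topology_alt by meson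
  have "\<forall>\<^sub>F n in sequentially. inverse (real (Suc n)) \<in> A"
    using AB topological_tendstoD [OF LIMSEQ_inverse_real_of_nat, of A] by simp
  then obtain n where "inverse (real (Suc n)) \<in> A"
    by (meson eventually_happens trivial_limit_sequentially)
  then have "(inverse (real (Suc n)), x) \<in> A \<times> B"
    using AB(2) by simp
  then have "x /\<^sub>R real (Suc n) \<in> O'"
    using AB(4) by auto
  then have "x /\<^sub>R real (Suc n) \<in> W"
    using O'(3) by (rule subsetD [rotated])
  then show thesis by (rule that)
qed

text \<open>Each operator is small near \<open>0\<close>, and solidity passes this on to its
  absolute value. Every further summand costs one halving of the neighbourhood, so the induction
  must leave \<open>W\<close> arbitrary.\<close>

lemma solid_nhd_sum_abs:
  fixes T :: "nat \<Rightarrow> 'x::real_normed_vector \<Rightarrow> 'e::vector_lattice"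
  assumes \<tau>: "locally_solid \<tau>" and W: "solid_nhd \<tau> W"
    and lin: "\<And>n. linear (T n)" and cont: "\<And>n. continuous_map euclidean \<tau> (T n)"
  shows "\<exists>d>0. \<forall>x. norm x < d \<longrightarrow> (\<Sum>n<N. \<bar>T n x\<bar>) \<in> W"
  using W
proof (induction N arbitrary: W)
  case 0
  then show ?case
    using solid_nhd_zero [OF 0] by (auto intro: exI [of _ 1])
next
  case (Suc N)
  obtain V where V: "solid_nhd \<tau> V" "\<And>a b. a \<in> V \<Longrightarrow> b \<in> V \<Longrightarrow> a + b \<in> W"
    using solid_nhd_add [OF \<tau> Suc.prems] by blast
  obtain d where d: "d > 0" "\<And>x. norm x < d \<Longrightarrow> (\<Sum>n<N. \<bar>T n x\<bar>) \<in> V"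
    using Suc.IH [OF V(1)] by blast
  obtain U where U: "openin \<tau> U" "0 \<in> U" "U \<subseteq> V"
    using V(1) unfolding solid_nhd_def by blast
  have "open {x. T N x \<in> U}"
    using openin_continuous_map_preimage [OF cont U(1)] by simp
  moreover have "0 \<in> {x. T N x \<in> U}"
    using U lin by (simp add: linear_0)
  ultimately obtain e where e: "e > 0" "ball 0 e \<subseteq> {x. T N x \<in> U}"
    by (meson open_contains_ball)
  have "\<bar>T N x\<bar> \<in> V" if "norm x < e" for x
  proof (rule solidD [OF solid_nhd_solid [OF V(1)]])
    show "T N x \<in> V" using e U that by auto
  qed simp
  then have "\<forall>x. norm x < min d e \<longrightarrow> (\<Sum>n<Suc N. \<bar>T n x\<bar>) \<in> W"
    using d V(2) by simp
  then show ?case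
    using d e by (intro exI [of _ "min d e"]) simp
qed

text \<open>The differences decrease and are nonnegative. A lower bound \<open>l\<close> of them
  makes \<open>s - l\<close> an upper bound of \<open>f\<close>, which forces
  \<open>s \<le> s - l\<close>; so their infimum is \<open>0\<close> and the \<sigma>-Lebesgue
  property applies.\<close>

lemma isLub_partial_sups_limitin:
  fixes f :: "nat \<Rightarrow> 'e::vector_lattice"
  assumes \<sigma>: "sigma_lebesgue_property \<tau>" and s: "isLub UNIV (range f) s"
  shows "limitin \<tau> (\<lambda>N. s - Sup_fin (f ` {..N})) 0 sequentially"
proof -
  let ?M = "\<lambda>N. Sup_fin (f ` {..N})"
  have ub: "f n \<le> s" for n
    using isLubD2 [OF s] by simp
  have le: "?M N \<le> s" for N
    using ub by (intro Sup_fin.boundedI) auto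
  have "decseq (\<lambda>N. s - ?M N)"
    unfolding decseq_def by (auto intro!: diff_left_mono Sup_fin.subset_imp)
  moreover have "isGlb UNIV (range (\<lambda>N. s - ?M N)) 0"
  proof (rule isGlbI2)
    show "isLb UNIV (range (\<lambda>N. s - ?M N)) 0"
      using le by (auto intro!: isLbI setgeI)
    show "Collect (isLb UNIV (range (\<lambda>N. s - ?M N))) *<= 0"
    proof (rule setleI, clarify)
      fix l assume l: "isLb UNIV (range (\<lambda>N. s - ?M N)) l"
      have "f n \<le> s - l" for n
      proof -
        have "f n \<le> ?M n" by (intro Sup_fin.coboundedI) auto
        moreover have "l \<le> s - ?M n" using isLbD [OF l] by simp
        ultimately have "f n + l \<le> ?M n + (s - ?M n)" by (rule add_mono)
        then show ?thesis by (simp add: le_diff_eq)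
      qed
      then have "isUb UNIV (range f) (s - l)"
        by (intro isUb_UNIV_I) auto
      then have "s \<le> s - l"
        by (rule isLub_le_isUb [OF s])
      then show "l \<le> 0" by simp
    qed
  qed
  ultimately show ?thesis
    using \<sigma> unfolding sigma_lebesgue_property_def by blast
qed

text \<open>Were all the closures without interior, Baire's theorem would leave their union without
  interior, although it is the whole space. The sets \<open>F n\<close> may fail to be closed, hence
  the closure in the conclusion.\<close>

lemma Baire_countable_cover:
  fixes F :: "nat \<Rightarrow> 'x::banach set"
  assumes "(\<Union>n. F n) = UNIV"
  obtains n x r where "r > 0" "ball x r \<subseteq> closure (F n)"
proof -
  have "\<exists>n. interior (closure (F n)) \<noteq> {}"
  proof (rule ccontr)
    assume "\<not> ?thesis"
    then have "euclidean interior_of (\<Union>n. closure (F n)) = {}"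
      by (intro Baire_category_alt) (auto simp: completely_metrizable_space_euclidean)
    moreover have "(\<Union>n. F n) \<subseteq> (\<Union>n. closure (F n))"
      by (intro UN_mono closure_subset order_refl)
    then have "(\<Union>n. closure (F n)) = UNIV"
      unfolding assms by (rule top_le)
    ultimately show False by simp
  qed
  then show thesis
    using that by (metis all_not_in_conv mem_interior)
qed

theorem lemma2p4:
  fixes \<tau> :: "'e::archimedean_vector_lattice topology"
    and T :: "nat \<Rightarrow> 'x::banach \<Rightarrow> 'e"
  assumes "dedekind_sigma_complete TYPE('e)"
    and "metrizable_space \<tau>" and "Hausdorff_space \<tau>"
    and "locally_solid \<tau>" and "sigma_lebesgue_property \<tau>"
    and "\<And>n. linear (T n)"
    and "\<And>n. continuous_map euclidean \<tau> (T n)"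
    and "\<And>x. order_bounded (range (\<lambda>n. T n x))"
  shows "(\<forall>x. isLub UNIV (range (\<lambda>n. \<bar>T n x\<bar>)) (maximal_operator T x)) \<and>
    (\<forall>x. 0 \<le> maximal_operator T x) \<and>
    topcontinuous_at euclidean \<tau> (maximal_operator T) 0"
proof -
  note \<tau> = \<open>locally_solid \<tau>\<close> and lin = \<open>\<And>n. linear (T n)\<close>
  let ?M = "maximal_operator T"
  have lub: "isLub UNIV (range (\<lambda>n. \<bar>T n x\<bar>)) (?M x)" for x
  proof -
    obtain b where "\<And>a. a \<in> range (\<lambda>n. T n x) \<Longrightarrow> \<bar>a\<bar> \<le> b"
      using order_bounded_abs [OF assms(8)] by blast
    then have "\<exists>b. \<forall>a\<in>range (\<lambda>n. \<bar>T n x\<bar>). a \<le> b"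
      by blast
    moreover have "countable (range (\<lambda>n. \<bar>T n x\<bar>))" "range (\<lambda>n. \<bar>T n x\<bar>) \<noteq> {}"
      by auto
    ultimately obtain s where s: "isLub UNIV (range (\<lambda>n. \<bar>T n x\<bar>)) s"
      using \<open>dedekind_sigma_complete TYPE('e)\<close> unfolding dedekind_sigma_complete_def by meson
    then show ?thesis
      by (simp only: maximal_operator_eqI [of T x s])
  qed
  have upper: "\<bar>T n x\<bar> \<le> ?M x" for n x
    using isLubD2 [OF lub] by simp
  have least: "?M x \<le> b" if "\<And>n. \<bar>T n x\<bar> \<le> b" for x b
    using that by (intro isLub_le_isUb [OF lub] isUb_UNIV_I) auto
  have nonneg: "0 \<le> ?M x" for x
    using upper [of 0 x] order_trans abs_ge_zero by metis
  have diff: "?M (x - y) \<le> ?M x + ?M y" for x y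
  proof (rule least)
    fix n
    have "\<bar>T n (x - y)\<bar> \<le> \<bar>T n x\<bar> + \<bar>T n y\<bar>"
      using lin by (simp add: linear_diff abs_triangle_ineq4)
    also have "\<dots> \<le> ?M x + ?M y" by (intro add_mono upper)
    finally show "\<bar>T n (x - y)\<bar> \<le> ?M x + ?M y" .
  qed
  have scale: "?M (c *\<^sub>R x) \<le> c *\<^sub>R ?M x" if "0 \<le> c" for c x
  proof (rule least)
    fix n
    have "\<bar>T n (c *\<^sub>R x)\<bar> \<le> c *\<^sub>R \<bar>T n x\<bar>"
      using abs_scaleR_le [OF that] lin by (simp add: linear_cmul)
    also have "\<dots> \<le> c *\<^sub>R ?M x" using upper that by (rule scaleR_left_mono)
    finally show "\<bar>T n (c *\<^sub>R x)\<bar> \<le> c *\<^sub>R ?M x" .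
  qed
  \<comment> \<open>Taking \<open>c = 0\<close> in \<open>scale\<close> bounds \<open>?M 0\<close>
    from above by \<open>0\<close>. Continuity at the origin thus concerns neighbourhoods of
    \<open>0\<close>.\<close>
  have zero: "?M 0 = 0"
    using scale [of 0 0] nonneg [of 0] by (simp add: antisym)
  have small: "\<exists>d>0. \<forall>x. norm x < d \<longrightarrow> ?M x \<in> W" if W: "solid_nhd \<tau> W" for W
  proof -
    \<comment> \<open>\<open>V\<close> and \<open>V2\<close> absorb a sum of three terms into
      \<open>V1\<close>; the last halving, from \<open>V1\<close> to \<open>W\<close>, pays for
      moving the ball to the origin.\<close>
    obtain V1 where V1: "solid_nhd \<tau> V1" "\<And>a b. a \<in> V1 \<Longrightarrow> b \<in> V1 \<Longrightarrow> a + b \<in> W"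
      using solid_nhd_add [OF \<tau> W] by blast
    obtain V2 where V2: "solid_nhd \<tau> V2" "\<And>a b. a \<in> V2 \<Longrightarrow> b \<in> V2 \<Longrightarrow> a + b \<in> V1"
      using solid_nhd_add [OF \<tau> V1(1)] by blast
    obtain V where V: "solid_nhd \<tau> V" "\<And>a b. a \<in> V \<Longrightarrow> b \<in> V \<Longrightarrow> a + b \<in> V2"
      using solid_nhd_add [OF \<tau> V2(1)] by blast
    note V_le = solid_le [OF solid_nhd_solid [OF V(1)]]
    have "V \<subseteq> V2"
      using V(2) [OF _ solid_nhd_zero [OF V(1)]] by auto
    have "(\<Union>n. {x. ?M x /\<^sub>R real (Suc n) \<in> V}) = UNIV"
      using solid_nhd_absorbing [OF \<tau> V(1)] by blast
    then obtain k x0 r where r: "r > 0"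
      and dense: "ball x0 r \<subseteq> closure {x. ?M x /\<^sub>R real (Suc k) \<in> V}"
      by (rule Baire_countable_cover)
    \<comment> \<open>Since \<open>c \<le> 1\<close>, solidity keeps nonnegative elements of
      \<open>V\<close> in \<open>V\<close> after scaling by \<open>c\<close>.\<close>
    define c where "c = inverse (real (Suc k))"
    have c: "0 < c" "c \<le> 1"
      by (auto simp: c_def field_simps)
    have c_le: "c *\<^sub>R a \<le> a" if "0 \<le> a" for a :: 'e
      using scaleR_right_mono [OF c(2) that] by simp
    have ball: "c *\<^sub>R ?M y \<in> V1" if y: "y \<in> ball x0 r" for y
    proof -
      let ?S = "\<lambda>N. Sup_fin ((\<lambda>n. \<bar>T n y\<bar>) ` {..N})"
      have S_le: "?S N \<le> ?M y" for N
        using upper by (intro Sup_fin.boundedI) auto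
      obtain U where U: "openin \<tau> U" "0 \<in> U" "U \<subseteq> V"
        using V(1) unfolding solid_nhd_def by blast
      have "\<forall>\<^sub>F N in sequentially. ?M y - ?S N \<in> U"
        using isLub_partial_sups_limitin [OF assms(5) lub] U unfolding limitin_def by blast
      then obtain N where N: "?M y - ?S N \<in> V"
        using U(3) by (meson eventually_happens subsetD trivial_limit_sequentially)
      \<comment> \<open>The order of choices matters: \<open>N\<close> depends on \<open>y\<close>
        alone, \<open>d\<close> on \<open>N\<close>, and only then is \<open>z\<close> picked within
        \<open>d\<close> of \<open>y\<close>.\<close>
      obtain d where d: "d > 0" "\<And>x. norm x < d \<Longrightarrow> (\<Sum>n<Suc N. \<bar>T n x\<bar>) \<in> V"
        using solid_nhd_sum_abs [where T = T and N = "Suc N", OF \<tau> V(1) lin assms(7)] by blast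
      have "y \<in> closure {x. ?M x /\<^sub>R real (Suc k) \<in> V}"
        using dense y by blast
      then obtain z where z: "c *\<^sub>R ?M z \<in> V" "dist z y < d"
        using d(1) unfolding closure_approachable c_def by blast
      \<comment> \<open>The range \<open>{..<Suc N}\<close> consists of exactly the indices
        \<open>n \<le> N\<close> occurring in \<open>?S N\<close>, so \<open>R\<close> dominates
        every \<open>\<bar>T n (y - z)\<bar>\<close> that is needed.\<close>
      define R where "R = (\<Sum>n<Suc N. \<bar>T n (y - z)\<bar>)"
      have "norm (y - z) < d"
        using z(2) by (simp add: dist_norm norm_minus_commute)
      then have R: "R \<in> V"
        unfolding R_def by (rule d(2))
      have "0 \<le> R"
        unfolding R_def by (intro sum_nonneg abs_ge_zero)
      have "?S N \<le> ?M z + R"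
      proof (rule Sup_fin.boundedI)
        fix a assume "a \<in> (\<lambda>n. \<bar>T n y\<bar>) ` {..N}"
        then obtain n where n: "n \<le> N" "a = \<bar>T n y\<bar>" by auto
        have "a \<le> \<bar>T n z\<bar> + \<bar>T n (y - z)\<bar>"
          using abs_triangle_ineq [of "T n z" "T n (y - z)"] n lin by (simp add: linear_diff)
        also have "\<bar>T n (y - z)\<bar> \<le> R"
          unfolding R_def
          using n(1) sum_mono2 [of "{..<Suc N}" "{n}" "\<lambda>n. \<bar>T n (y - z)\<bar>"] by simp
        also have "\<bar>T n z\<bar> + R \<le> ?M z + R"
          by (intro add_right_mono upper)
        finally show "a \<le> ?M z + R" by simp
      qed auto
      \<comment> \<open>Split \<open>?M y\<close> as \<open>(?M y - ?S N) + ?S N\<close> and bound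
        the second part. After scaling by \<open>c\<close>, each of the three resulting terms lies
        in \<open>V\<close>.\<close>
      then have "?M y \<le> (?M y - ?S N) + (?M z + R)"
        using add_left_mono [of "?S N" "?M z + R" "?M y - ?S N"] by simp
      then have "c *\<^sub>R ?M y \<le> c *\<^sub>R ((?M y - ?S N) + (?M z + R))"
        using c by (intro scaleR_left_mono) auto
      then have le: "c *\<^sub>R ?M y \<le> c *\<^sub>R (?M y - ?S N) + (c *\<^sub>R ?M z + c *\<^sub>R R)"
        by (simp only: scaleR_add_right)
      have "c *\<^sub>R (?M y - ?S N) \<in> V"
        using S_le c(1) by (intro V_le [OF N] scaleR_nonneg_nonneg c_le) simp_all
      moreover have "c *\<^sub>R R \<in> V"
        using \<open>0 \<le> R\<close> c(1) by (intro V_le [OF R] scaleR_nonneg_nonneg c_le) simp_all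
      ultimately have "c *\<^sub>R (?M y - ?S N) + (c *\<^sub>R ?M z + c *\<^sub>R R) \<in> V1"
        using z(1) V(2) V2(2) \<open>V \<subseteq> V2\<close> by blast
      moreover have "0 \<le> c *\<^sub>R ?M y"
        using nonneg c by (intro scaleR_nonneg_nonneg) auto
      ultimately show ?thesis
        using le solid_le [OF solid_nhd_solid [OF V1(1)]] by blast
    qed
    have "?M w \<in> W" if w: "norm w < c * r" for w
    proof -
      \<comment> \<open>Chosen so that \<open>w\<close> equals \<open>c *\<^sub>R (?y - x0)\<close>;
        the radius \<open>c * r\<close> is what puts \<open>?y\<close> into
        \<open>ball x0 r\<close>.\<close>
      let ?y = "x0 + w /\<^sub>R c"
      have "norm w / c < r"
        using w c by (simp add: field_simps)
      then have y: "?y \<in> ball x0 r"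
        using c by (simp add: dist_norm divide_inverse mult.commute)
      have "?M w \<le> c *\<^sub>R ?M (?y - x0)"
        using scale [of c "?y - x0"] c by simp
      also have "\<dots> \<le> c *\<^sub>R (?M ?y + ?M x0)"
        using c(1) by (intro scaleR_left_mono diff) simp
      finally have "?M w \<le> c *\<^sub>R ?M ?y + c *\<^sub>R ?M x0"
        by (simp add: scaleR_add_right)
      \<comment> \<open>The estimate \<open>ball\<close> is used twice, at \<open>?y\<close> and at
        the centre \<open>x0\<close>, which lies in the ball because \<open>r > 0\<close>.\<close>
      moreover have "c *\<^sub>R ?M ?y + c *\<^sub>R ?M x0 \<in> W"
        using ball y r by (intro V1(2)) auto
      ultimately show ?thesis
        using solid_le [OF solid_nhd_solid [OF W]] nonneg by blast
    qed
    then show ?thesis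
      using c r by (intro exI [of _ "c * r"]) auto
  qed
  have "topcontinuous_at euclidean \<tau> ?M 0"
    unfolding topcontinuous_at_def
  proof (intro conjI allI impI)
    show "?M \<in> topspace euclidean \<rightarrow> topspace \<tau>"
      using \<tau> unfolding locally_solid_def linear_topology_def by simp
    fix O' assume "openin \<tau> O' \<and> ?M 0 \<in> O'"
    then obtain W where W: "solid_nhd \<tau> W" "W \<subseteq> O'"
      using solid_nhd_subset [OF \<tau>] zero by metis
    obtain d where "d > 0" "\<And>x. norm x < d \<Longrightarrow> ?M x \<in> W"
      using small [OF W(1)] by blast
    then show "\<exists>U. openin euclidean U \<and> 0 \<in> U \<and> (\<forall>y\<in>U. ?M y \<in> O')"
      using W(2) by (intro exI [of _ "ball 0 d"]) auto
  qed simp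
  with lub nonneg show ?thesis by blast
qed

end
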